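(* Let $W$ be an $N\times N$ matrix weight with monic matrix valued orthogonal polynomials $P(x,n)$, $n\ge 0$. Suppose that there are a constant matrix $A\in M_N(\mathbb{C})$ and a scalar polynomial $v(x)$ of degree $k$ such that the differential operator (acting from the right) $\mathcal{D}=\partial_x+A$ has adjoint with respect to $W$ given by $$\mathcal{D}^\dagger=-\mathcal{D}+v'(x).$$ Then the monic polynomials $P(x,n)$ satisfy the lowering relation $$P\cdot\mathcal{D}=M\cdot P,\qquad M=\sum_{j=-k+1}^{0}A_j(n)\,\delta^{j},$$ that is, $P'(x,n)+P(x,n)A=\sum_{j=-k+1}^{0}A_j(n)P(x,n+j)$ for all $n\ge0$, where $$A_0(n)=A,\qquad A_j(n)=\left(v'(L)\right)_j(n)\quad (j\neq 0).$$
   Context: $W$ is a positive definite $M_N(\mathbb{C})$-valued weight function on a (possibly infinite) interval $[a,b]\subset\mathbb{R}$ with finite moments of all orders; $\langle H,G\rangle=\int_a^b H(y)W(y)G(y)^*\,dy$. The monic matrix valued orthogonal polynomials (MVOPs) $P(x,n)=x^nI+\cdots$ are the unique monic polynomials with $\langle P(\cdot,n),P(\cdot,m)\rangle=\mathcal{H}(n)\delta_{n,m}$, $\mathcal{H}(n)$ positive definite. They satisfy $xP(x,n)=P(x,n+1)+B(n)P(x,n)+C(n)P(x,n-1)$ with $B(n),C(n)\in M_N(\mathbb{C})$, $C(0):=0$. Differential operators act from the right: $F\cdot(\partial_x+A)=F'+FA$, and a scalar function $v'(x)$ acts by multiplication. The operator $\mathcal{D}^\dagger$ is the adjoint of $\mathcal{D}$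 with respect to $W$ if $\langle F\cdot\mathcal{D},G\rangle=\langle F,G\cdot\mathcal{D}^\dagger\rangle$ for all matrix valued polynomials $F,G$. Difference operators $M=\sum_j A_j(n)\delta^j$ act from the left by $(M\cdot P)(x,n)=\sum_jA_j(n)P(x,n+j)$; sequences are taken to be $0$ at negative integers. They are composed by $(A(n)\delta^i)(B(n)\delta^j)=A(n)B(n+i)\delta^{i+j}$. Let $L=\delta+B(n)+C(n)\delta^{-1}$ be the difference operator of the three-term recurrence, so $xP=L\cdot P$. For a scalar polynomial $q$, $(q(L))_j(n)$ denotes the coefficient of $\delta^j$ in $q(L)=\sum_{j=-\deg q}^{\deg q}(q(L))_j(n)\,\delta^j$. *)

theory Defs
  imports "HOL-Analysis.Analysis" "HOL-Computational_Algebra.Polynomial"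
begin

text \<open>
  \<open>M\<^sub>N(\<complex>)\<close> is \<open>complex^'n^'n\<close> with \<open>N = CARD('n)\<close>. Matrix valued polynomials are elements of
  \<open>M\<^sub>N(\<complex>[x])\<close>, i.e. matrices with polynomial entries, so that the product of matrix valued
  polynomials is the library's \<open>**\<close> and multiplication by a scalar polynomial \<open>q\<close> is \<open>mat q **\<close>.
  The product \<open>*\<close> on \<open>'a^'n^'n\<close> is entrywise and is never used here.
\<close>

type_synonym 'n cmat = "complex^'n^'n"
type_synonym 'n matpoly = "(complex poly)^'n^'n"

definition conj_transpose :: "'n::finite cmat \<Rightarrow> 'n cmat" where
  "conj_transpose X = (\<chi> i j. cnj (X $ j $ i))"

definition pos_def :: "'n::finite cmat \<Rightarrow> bool" where
  "pos_def X \<longleftrightarrow> conj_transpose X = X \<and>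
     (\<forall>u. u \<noteq> 0 \<longrightarrow> 0 < Re (\<Sum>i\<in>UNIV. cnj (u $ i) * (X *v u) $ i))"

definition mp_const :: "'n::finite cmat \<Rightarrow> 'n matpoly" where
  "mp_const X = (\<chi> i j. [:X $ i $ j:])"

definition mp_eval :: "'n::finite matpoly \<Rightarrow> real \<Rightarrow> 'n cmat" where
  "mp_eval F x = (\<chi> i j. poly (F $ i $ j) (complex_of_real x))"

definition mp_coeff :: "'n::finite matpoly \<Rightarrow> nat \<Rightarrow> 'n cmat" where
  "mp_coeff F m = (\<chi> i j. coeff (F $ i $ j) m)"

definition mp_deriv :: "'n::finite matpoly \<Rightarrow> 'n matpoly" where
  "mp_deriv F = (\<chi> i j. pderiv (F $ i $ j))"

definition mp_monic :: "nat \<Rightarrow> 'n::finite matpoly \<Rightarrow> bool" where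
  "mp_monic n F \<longleftrightarrow> mp_coeff F n = mat 1 \<and> (\<forall>m>n. mp_coeff F m = 0)"

definition ereal_icc :: "ereal \<Rightarrow> ereal \<Rightarrow> real set" where
  "ereal_icc a b = {x. a \<le> ereal x \<and> ereal x \<le> b}"

text \<open>
  Positivity is required almost everywhere, so that weights degenerating at an endpoint
  (Jacobi, Laguerre type) are included. The case \<open>m = 0\<close> of the moment condition contains the
  measurability of \<open>W\<close> on the interval.
\<close>

definition matrix_weight :: "ereal \<Rightarrow> ereal \<Rightarrow> (real \<Rightarrow> 'n::finite cmat) \<Rightarrow> bool" where
  "matrix_weight a b W \<longleftrightarrow> a < b \<and>
     (AE x in lebesgue. x \<in> ereal_icc a b \<longrightarrow> pos_def (W x)) \<and>
     (\<forall>m::nat. set_integrable lebesgue (ereal_icc a b) (\<lambda>x. x ^ m *\<^sub>R W x))"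

definition mv_inner ::
  "ereal \<Rightarrow> ereal \<Rightarrow> (real \<Rightarrow> 'n::finite cmat) \<Rightarrow> 'n matpoly \<Rightarrow> 'n matpoly \<Rightarrow> 'n cmat" where
  "mv_inner a b W F G =
     (LINT y:ereal_icc a b|lebesgue. mp_eval F y ** W y ** conj_transpose (mp_eval G y))"

definition monic_mvops ::
  "ereal \<Rightarrow> ereal \<Rightarrow> (real \<Rightarrow> 'n::finite cmat) \<Rightarrow> (nat \<Rightarrow> 'n matpoly) \<Rightarrow> bool" where
  "monic_mvops a b W P \<longleftrightarrow> (\<forall>n. mp_monic n (P n)) \<and>
     (\<exists>H. (\<forall>n. pos_def (H n)) \<and>
          (\<forall>n m. mv_inner a b W (P n) (P m) = (if n = m then H n else 0)))"

text \<open>Operators are written as functions; \<open>rdop A F\<close> is \<open>F \<cdot> (\<partial>\<^sub>x + A)\<close>.\<close>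

definition rdop :: "'n::finite cmat \<Rightarrow> 'n matpoly \<Rightarrow> 'n matpoly" where
  "rdop A F = mp_deriv F + F ** mp_const A"

definition is_adjoint ::
  "ereal \<Rightarrow> ereal \<Rightarrow> (real \<Rightarrow> 'n::finite cmat) \<Rightarrow>
   ('n matpoly \<Rightarrow> 'n matpoly) \<Rightarrow> ('n matpoly \<Rightarrow> 'n matpoly) \<Rightarrow> bool" where
  "is_adjoint a b W D D' \<longleftrightarrow> (\<forall>F G. mv_inner a b W (D F) G = mv_inner a b W F (D' G))"

text \<open>Extension of a sequence by zero to the negative integers.\<close>

definition zext :: "(nat \<Rightarrow> 'a::zero) \<Rightarrow> int \<Rightarrow> 'a" where
  "zext s n = (if n < 0 then 0 else s (nat n))"

text \<open>
  A difference operator \<open>\<Sum>\<^sub>j A\<^sub>j(n) \<delta>\<^sup>j\<close> is represented by its coefficients \<open>\<lambda>j n. A\<^sub>j(n)\<close>, which are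
  meant to vanish for all but finitely many \<open>j\<close>; the sums below range over the support.
\<close>

type_synonym 'n diffop = "int \<Rightarrow> nat \<Rightarrow> 'n cmat"

definition dop_supp :: "'n::finite diffop \<Rightarrow> int set" where
  "dop_supp S = {j. \<exists>n. S j n \<noteq> 0}"

definition dop_act :: "'n::finite diffop \<Rightarrow> (nat \<Rightarrow> 'n matpoly) \<Rightarrow> nat \<Rightarrow> 'n matpoly" where
  "dop_act S P n = (\<Sum>j\<in>dop_supp S. mp_const (S j n) ** zext P (int n + j))"

definition dop_comp :: "'n::finite diffop \<Rightarrow> 'n diffop \<Rightarrow> 'n diffop" where
  "dop_comp S T j n = (\<Sum>i\<in>dop_supp S. S i n ** zext (T (j - i)) (int n + i))"

primrec dop_pow :: "'n::finite diffop \<Rightarrow> nat \<Rightarrow> 'n diffop" where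
  "dop_pow S 0 = (\<lambda>j n. if j = 0 then mat 1 else 0)"
| "dop_pow S (Suc m) = dop_comp S (dop_pow S m)"

definition dop_poly :: "complex poly \<Rightarrow> 'n::finite diffop \<Rightarrow> 'n diffop" where
  "dop_poly q S j n = (\<Sum>m\<le>degree q. mat (coeff q m) ** dop_pow S m j n)"

text \<open>
  For monic \<open>P\<close> the recurrence determines \<open>B\<close> and, given \<open>C 0 = 0\<close>, also \<open>C\<close>.
\<close>

definition three_term_coeffs ::
  "(nat \<Rightarrow> 'n::finite matpoly) \<Rightarrow> (nat \<Rightarrow> 'n cmat) \<Rightarrow> (nat \<Rightarrow> 'n cmat) \<Rightarrow> bool" where
  "three_term_coeffs P B C \<longleftrightarrow> C 0 = 0 \<and>
     (\<forall>n. mat [:0, 1:] ** P n =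
        P (n + 1) + mp_const (B n) ** P n + mp_const (C n) ** zext P (int n - 1))"

definition recurrence_op :: "(nat \<Rightarrow> 'n::finite cmat) \<Rightarrow> (nat \<Rightarrow> 'n cmat) \<Rightarrow> 'n diffop" where
  "recurrence_op B C j n =
     (if j = 1 then mat 1 else if j = 0 then B n else if j = - 1 then C n else 0)"

end

theory Submission
  imports Defs
begin

text \<open>
  Write \<open>r = v'\<close>, let \<open>H\<close> be the squared norms of the \<open>P n\<close>, and expand \<open>P n \<cdot> \<D>\<close> in the basis
  \<open>P 0, P 1, \<dots>\<close>. It has degree at most \<open>n\<close> with \<open>n\<close>-th coefficient \<open>A\<close>, so the coefficient of
  \<open>P n\<close> in the expansion is \<open>A\<close> and only the terms \<open>P m\<close> with \<open>m < n\<close> remain. For these the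
  adjoint relation gives
  \<open>\<langle>P n \<cdot> \<D>, P m\<rangle> = - \<langle>P n, P m \<cdot> \<D>\<rangle> + \<langle>P n, r P m\<rangle> = \<langle>P n, r P m\<rangle>\<close>,
  because \<open>P m \<cdot> \<D>\<close> has degree at most \<open>m < n\<close> and is therefore orthogonal to \<open>P n\<close>.

  If \<open>r\<close> can be moved to the left entry, the right hand side is \<open>\<langle>r P n, P m\<rangle>\<close>. Since
  \<open>r P = r(L) \<cdot> P\<close> (lemma \<open>dop_act_poly\<close>), this equals \<open>(r(L))\<^sub>j(n) H(m)\<close> with \<open>j = m - n\<close>, and
  dividing by the invertible \<open>H(m)\<close> yields the asserted coefficients. They vanish for \<open>j \<le> -k\<close>,
  since \<open>L\<close> shifts by at most one and \<open>r\<close> has degree \<open>k - 1\<close>.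

  Moving \<open>r\<close> across the inner product replaces it by its complex conjugate, and \<open>v\<close> is a complex
  polynomial. But taking the adjoint twice gives back \<open>\<D>\<close>, and this forces \<open>r\<close> to have real
  coefficients (lemma \<open>adjoint_potential_real\<close>).

  A constant \<open>v\<close> needs a separate argument: then the sum from \<open>-k + 1 = 1\<close> to \<open>0\<close> is empty and does
  not contain the term \<open>A\<close>. In that case the expansion reads \<open>P 1 \<cdot> \<D> = A P 1\<close>, which the trace of
  the constant coefficient shows to be impossible (lemma \<open>rdop_monic_linear_neq\<close>), so no weight
  admits such an adjoint relation.
\<close>

section \<open>Matrix valued polynomials\<close>

lemma matrix_mult_add_left: "(X + Y) ** (Z :: 'a::semiring_1^'n^'n) = X ** Z + Y ** Z"
  by (simp add: matrix_matrix_mult_def vec_eq_iff distrib_right sum.distrib)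

lemma matrix_mult_sum_left: "sum f J ** (Y :: 'a::semiring_1^'n^'n) = (\<Sum>j\<in>J. f j ** Y)"
  by (induction J rule: infinite_finite_induct) (simp_all add: matrix_mult_add_left)

lemma matrix_mult_sum_right: "(Y :: 'a::semiring_1^'n^'n) ** sum f J = (\<Sum>j\<in>J. Y ** f j)"
  by (induction J rule: infinite_finite_induct) (simp_all add: matrix_add_ldistrib)

lemma matrix_mult_scaleR_left: "(c *\<^sub>R X) ** Y = c *\<^sub>R (X ** (Y :: 'n::finite cmat))"
  by (simp add: matrix_matrix_mult_def vec_eq_iff scaleR_sum_right)

lemma matrix_mult_scaleR_right: "X ** (c *\<^sub>R Y) = c *\<^sub>R (X ** (Y :: 'n::finite cmat))"
  by (simp add: matrix_matrix_mult_def vec_eq_iff scaleR_sum_right)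

lemma mat_mult_component: "(mat c ** (X :: 'a::semiring_1^'n^'n)) $ i $ j = c * X $ i $ j"
proof -
  have "(mat c ** X) $ i $ j = (\<Sum>k\<in>UNIV. if k = i then c * X $ k $ j else 0)"
    unfolding matrix_matrix_mult_def mat_def vec_lambda_beta by (intro sum.cong) auto
  then show ?thesis by simp
qed

lemma mult_mat_component: "((X :: 'a::comm_semiring_1^'n^'n) ** mat c) $ i $ j = c * X $ i $ j"
proof -
  have "(X ** mat c) $ i $ j = (\<Sum>k\<in>UNIV. if k = j then c * X $ i $ k else 0)"
    unfolding matrix_matrix_mult_def mat_def vec_lambda_beta
    by (intro sum.cong) (auto simp: mult.commute)
  then show ?thesis by simp
qed

lemma mat_central: "mat c ** (X :: 'a::comm_semiring_1^'n^'n) = X ** mat c"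
  by (simp add: vec_eq_iff mat_mult_component mult_mat_component)

lemma mat_left_commute: "X ** (mat c ** Y) = mat c ** ((X :: 'a::comm_semiring_1^'n^'n) ** Y)"
  by (metis mat_central matrix_mul_assoc)

lemma mat_mult_mat: "mat c ** mat d = (mat (c * d) :: 'a::semiring_1^'n^'n)"
  by (simp only: vec_eq_iff mat_mult_component) (simp add: mat_def)

lemma mat_add: "mat c + mat d = (mat (c + d) :: 'a::semiring_1^'n^'n)"
  by (simp add: vec_eq_iff mat_def)

lemma mat_diff: "mat c - mat d = (mat (c - d) :: 'a::ring_1^'n^'n)"
  by (simp add: vec_eq_iff mat_def)

lemma mat_sum: "mat (sum f J) = (\<Sum>j\<in>J. mat (f j) :: 'a::semiring_1^'n^'n)"
  by (induction J rule: infinite_finite_induct) (simp_all add: mat_add[symmetric])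

lemma mp_const_0: "mp_const 0 = 0"
  by (simp add: mp_const_def vec_eq_iff)

lemma mp_const_add: "mp_const (X + Y) = mp_const X + mp_const Y"
  by (simp add: mp_const_def vec_eq_iff)

lemma mp_const_sum: "mp_const (sum f J) = (\<Sum>j\<in>J. mp_const (f j))"
  by (induction J rule: infinite_finite_induct) (simp_all add: mp_const_0 mp_const_add)

lemma mp_const_mult: "mp_const (X ** Y) = mp_const X ** mp_const Y"
  by (simp add: mp_const_def vec_eq_iff matrix_matrix_mult_def poly_eq_iff coeff_sum coeff_pCons mult.commute
      split: nat.split)

lemma mp_const_mat: "mp_const (mat c) = mat [:c:]"
  by (simp add: mp_const_def vec_eq_iff mat_def)

lemma mp_coeff_add: "mp_coeff (F + G) m = mp_coeff F m + mp_coeff G m"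
  by (simp add: mp_coeff_def vec_eq_iff)

lemma mp_coeff_diff: "mp_coeff (F - G) m = mp_coeff F m - mp_coeff G m"
  by (simp add: mp_coeff_def vec_eq_iff)

lemma mp_coeff_const_mult: "mp_coeff (mp_const X ** F) m = X ** mp_coeff F m"
  by (simp add: mp_coeff_def mp_const_def vec_eq_iff matrix_matrix_mult_def coeff_sum)

lemma mp_coeff_mult_const: "mp_coeff (F ** mp_const X) m = mp_coeff F m ** X"
  by (simp add: mp_coeff_def mp_const_def vec_eq_iff matrix_matrix_mult_def coeff_sum mult.commute)

lemma mp_coeff_deriv: "mp_coeff (mp_deriv F) m = mat (of_nat (Suc m)) ** mp_coeff F (Suc m)"
  by (simp add: vec_eq_iff mat_mult_component) (simp add: mp_coeff_def mp_deriv_def coeff_pderiv)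

lemma mp_eq_0_iff: "F = 0 \<longleftrightarrow> (\<forall>m. mp_coeff F m = 0)"
  by (auto simp: mp_coeff_def vec_eq_iff poly_eq_iff)

lemma mp_eval_add: "mp_eval (F + G) x = mp_eval F x + mp_eval G x"
  by (simp add: mp_eval_def vec_eq_iff)

lemma mp_eval_mult: "mp_eval (F ** G) x = mp_eval F x ** mp_eval G x"
  by (simp add: mp_eval_def vec_eq_iff matrix_matrix_mult_def poly_sum)

lemma mp_eval_const: "mp_eval (mp_const X) x = X"
  by (simp add: mp_eval_def mp_const_def vec_eq_iff)

lemma mp_eval_mat: "mp_eval (mat q) x = mat (poly q (complex_of_real x))"
  by (simp add: mp_eval_def mat_def vec_eq_iff)

lemma ex_degree_bound: "\<exists>d. \<forall>m>d. mp_coeff F m = 0"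
proof (intro exI allI impI)
  let ?D = "(\<lambda>(i, j). degree (F $ i $ j)) ` UNIV"
  fix m assume m: "m > Max ?D"
  have "degree (F $ i $ j) \<le> Max ?D" for i j
    by (rule Max_ge) (auto intro: rev_image_eqI[of "(i, j)"])
  with m have "degree (F $ i $ j) < m" for i j
    using le_less_trans by blast
  then show "mp_coeff F m = 0"
    by (simp add: mp_coeff_def vec_eq_iff coeff_eq_0)
qed

text \<open>
  Powers of the real variable come out as real scalars, so that integrands built from \<open>mp_eval\<close>
  become finite sums of bounded real linear images of the moment integrands.
\<close>

lemma mp_eval_altdef:
  assumes "\<And>m. m > d \<Longrightarrow> mp_coeff F m = 0"
  shows "mp_eval F x = (\<Sum>m\<le>d. x ^ m *\<^sub>R mp_coeff F m)"
proof -
  have "poly (F $ i $ j) (complex_of_real x) = (\<Sum>m\<le>d. x ^ m *\<^sub>R coeff (F $ i $ j) m)" for i j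
  proof -
    have "degree (F $ i $ j) \<le> d"
      by (rule degree_le) (use assms in \<open>auto simp: mp_coeff_def vec_eq_iff\<close>)
    then have "poly (F $ i $ j) (of_real x) = (\<Sum>m\<le>d. coeff (F $ i $ j) m * of_real x ^ m)"
      unfolding poly_altdef by (intro sum.mono_neutral_left) (auto simp: coeff_eq_0)
    then show ?thesis by (simp add: scaleR_conv_of_real mult.commute)
  qed
  then show ?thesis
    by (simp add: mp_eval_def mp_coeff_def vec_eq_iff)
qed

lemma conj_transpose_mult: "conj_transpose (X ** Y) = conj_transpose Y ** conj_transpose X"
  by (simp add: conj_transpose_def vec_eq_iff matrix_matrix_mult_def mult.commute)

lemma conj_transpose_invol: "conj_transpose (conj_transpose X) = X"
  by (simp add: conj_transpose_def vec_eq_iff)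

lemma conj_transpose_0: "conj_transpose 0 = 0"
  by (simp add: conj_transpose_def vec_eq_iff)

lemma conj_transpose_diff: "conj_transpose (X - Y) = conj_transpose X - conj_transpose Y"
  by (simp add: conj_transpose_def vec_eq_iff)

lemma conj_transpose_add: "conj_transpose (X + Y) = conj_transpose X + conj_transpose Y"
  by (simp add: conj_transpose_def vec_eq_iff)

lemma conj_transpose_mat: "conj_transpose (mat c) = mat (cnj c)"
  by (simp add: conj_transpose_def vec_eq_iff mat_def)

lemma bounded_linear_conj_transpose: "bounded_linear (conj_transpose :: 'n::finite cmat \<Rightarrow> _)"
  by (intro linear_conv_bounded_linear[THEN iffD1] linearI)
    (simp_all add: conj_transpose_def vec_eq_iff)

lemma bounded_linear_matrix_mult_left: "bounded_linear (\<lambda>M. (X :: 'n::finite cmat) ** M)"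
  by (intro linear_conv_bounded_linear[THEN iffD1] linearI)
    (simp_all add: scaleR_sum_right matrix_matrix_mult_def vec_eq_iff sum.distrib distrib_left)

lemma bounded_linear_matrix_mult_right: "bounded_linear (\<lambda>M. M ** (X :: 'n::finite cmat))"
  by (intro linear_conv_bounded_linear[THEN iffD1] linearI)
    (simp_all add: scaleR_sum_right matrix_matrix_mult_def vec_eq_iff sum.distrib distrib_right)

text \<open>
  Positivity makes the kernel of \<open>H\<close> trivial, so \<open>H\<close> is invertible; this allows coefficients to be
  read off from inner products.
\<close>

lemma pos_def_cancel_right:
  assumes "pos_def H" "X ** H = 0"
  shows "X = 0"
proof -
  have "inj ((*v) H)"
  proof (subst vec.inj_iff_eq_0, intro allI impI)
    fix u assume "H *v u = 0"
    then show "u = 0" using assms(1) unfolding pos_def_def by fastforce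
  qed
  then obtain B where "B ** H = mat 1"
    using matrix_left_invertible_injective[of H] by blast
  then have "H ** B = mat 1" by (rule matrix_left_right_inverse[THEN iffD1])
  then have "X = (X ** H) ** B" by (simp add: matrix_mul_assoc[symmetric])
  with assms(2) show ?thesis by simp
qed

section \<open>The matrix valued inner product\<close>

lemma set_integrable_bounded_linear:
  assumes "bounded_linear T" "set_integrable M I f"
  shows "set_integrable M I (\<lambda>x. T (f x))"
  using integrable_bounded_linear[OF assms(1), of M "\<lambda>x. indicator I x *\<^sub>R f x"] assms
  by (simp add: set_integrable_def bounded_linear.linear linear_scale)

lemma set_integral_bounded_linear:
  assumes "bounded_linear T" "set_integrable M I f"
  shows "(LINT x:I|M. T (f x)) = T (LINT x:I|M. f x)"
  using integral_bounded_linear[OF assms(1), of M "\<lambda>x. indicator I x *\<^sub>R f x"] assms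
  by (simp add: set_integrable_def set_lebesgue_integral_def bounded_linear.linear linear_scale)

lemma set_integrable_sum:
  fixes f :: "'i \<Rightarrow> 'a \<Rightarrow> 'b::{banach, second_countable_topology}"
  assumes "\<And>i. i \<in> J \<Longrightarrow> set_integrable M I (f i)"
  shows "set_integrable M I (\<lambda>x. \<Sum>i\<in>J. f i x)"
  using assms by (simp add: set_integrable_def scaleR_sum_right)

text \<open>
  Expanding both polynomials in powers of \<open>y\<close> turns the integrand into a finite sum of terms
  \<open>F\<^sub>m (y\<^bsup>m+l\<^esup> W y) G\<^sub>l\<^sup>*\<close>, each a bounded linear image of a moment integrand.
\<close>

lemma mv_integrable:
  fixes W :: "real \<Rightarrow> 'n::finite cmat"
  assumes "matrix_weight a b W"
  shows "set_integrable lebesgue (ereal_icc a b)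
           (\<lambda>y. mp_eval F y ** W y ** conj_transpose (mp_eval G y))"
proof -
  obtain d e where d: "\<And>m. m > d \<Longrightarrow> mp_coeff F m = 0" and e: "\<And>m. m > e \<Longrightarrow> mp_coeff G m = 0"
    using ex_degree_bound by metis
  define T where "T m l X = mp_coeff F m ** X ** conj_transpose (mp_coeff G l)" for m l X
  have T: "bounded_linear (T m l)" for m l
    unfolding T_def
    by (intro bounded_linear_compose[OF bounded_linear_matrix_mult_right]
        bounded_linear_matrix_mult_left)
  have ct: "linear (conj_transpose :: 'n cmat \<Rightarrow> _)"
    by (rule bounded_linear.linear[OF bounded_linear_conj_transpose])
  have "mp_eval F y ** W y ** conj_transpose (mp_eval G y) =
        (\<Sum>m\<le>d. \<Sum>l\<le>e. T m l (y ^ (m + l) *\<^sub>R W y))" for y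
    by (simp add: T_def mp_eval_altdef[OF d] mp_eval_altdef[OF e] linear_sum[OF ct]
        linear_scale[OF ct] matrix_mult_sum_left matrix_mult_sum_right matrix_mult_scaleR_left
        matrix_mult_scaleR_right power_add scaleR_sum_right)
      (subst sum.swap, simp add: mult.commute)
  moreover have "set_integrable lebesgue (ereal_icc a b)
     (\<lambda>y. \<Sum>m\<le>d. \<Sum>l\<le>e. T m l (y ^ (m + l) *\<^sub>R W y))"
    using assms unfolding matrix_weight_def
    by (intro set_integrable_sum set_integrable_bounded_linear[OF T]) auto
  ultimately show ?thesis by simp
qed

lemma mv_inner_add_left:
  assumes "matrix_weight a b W"
  shows "mv_inner a b W (F + G) K = mv_inner a b W F K + mv_inner a b W G K"
  unfolding mv_inner_def
  by (simp add: mp_eval_add matrix_mult_add_left set_integral_add(2) mv_integrable[OF assms])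

lemma mv_inner_const_left:
  assumes "matrix_weight a b W"
  shows "mv_inner a b W (mp_const X ** F) G = X ** mv_inner a b W F G"
  unfolding mv_inner_def
  by (subst set_integral_bounded_linear[OF bounded_linear_matrix_mult_left
        mv_integrable[OF assms], symmetric])
    (simp add: mp_eval_mult mp_eval_const matrix_mul_assoc)

lemma mv_inner_0_left: "mv_inner a b W 0 G = 0"
  unfolding mv_inner_def by (simp add: mp_eval_def zero_vec_def[symmetric] set_lebesgue_integral_def)

lemma mv_inner_diff_left:
  assumes "matrix_weight a b W"
  shows "mv_inner a b W (F - G) K = mv_inner a b W F K - mv_inner a b W G K"
  using mv_inner_add_left[OF assms, of "F - G" G K] by simp

lemma mv_inner_sum_left:
  assumes "matrix_weight a b W"
  shows "mv_inner a b W (sum f J) G = (\<Sum>j\<in>J. mv_inner a b W (f j) G)"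
  by (induction J rule: infinite_finite_induct)
    (simp_all add: mv_inner_0_left mv_inner_add_left[OF assms])

text \<open>
  The weight is Hermitian almost everywhere, so the conjugate transpose exchanges the two entries.
  Together with linearity in the first entry this gives the properties of the second entry.
\<close>

lemma mv_inner_hermitian:
  assumes "matrix_weight a b W"
  shows "conj_transpose (mv_inner a b W F G) = mv_inner a b W G F"
proof -
  let ?I = "ereal_icc a b"
  let ?f = "\<lambda>F G y. mp_eval F y ** W y ** conj_transpose (mp_eval G y)"
  have int: "set_integrable lebesgue ?I (?f G F)"
    "set_integrable lebesgue ?I (\<lambda>y. conj_transpose (?f F G y))"
    by (intro set_integrable_bounded_linear[OF bounded_linear_conj_transpose] mv_integrable assms)+
  have W: "AE y in lebesgue. y \<in> ?I \<longrightarrow> pos_def (W y)"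
    using assms by (simp add: matrix_weight_def)
  have "conj_transpose (mv_inner a b W F G) = (LINT y:?I|lebesgue. conj_transpose (?f F G y))"
    unfolding mv_inner_def
    by (rule set_integral_bounded_linear[symmetric, OF bounded_linear_conj_transpose
          mv_integrable[OF assms]])
  also have "\<dots> = mv_inner a b W G F"
    unfolding mv_inner_def set_lebesgue_integral_def
  proof (rule integral_cong_AE)
    show "AE y in lebesgue. indicator ?I y *\<^sub>R conj_transpose (?f F G y) = indicator ?I y *\<^sub>R ?f G F y"
      using W
      by eventually_elim
        (auto simp: indicator_def pos_def_def conj_transpose_mult conj_transpose_invol matrix_mul_assoc)
  qed (use int in \<open>simp_all add: set_integrable_def borel_measurable_integrable\<close>)
  finally show ?thesis .
qed

lemma mv_inner_add_right:
  assumes "matrix_weight a b W"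
  shows "mv_inner a b W K (F + G) = mv_inner a b W K F + mv_inner a b W K G"
  using mv_inner_add_left[OF assms, of F G K]
  by (metis mv_inner_hermitian[OF assms] conj_transpose_add)

lemma mv_inner_diff_right:
  assumes "matrix_weight a b W"
  shows "mv_inner a b W K (F - G) = mv_inner a b W K F - mv_inner a b W K G"
  using mv_inner_add_right[OF assms, of K "F - G" G] by simp

text \<open>
  Scalar polynomials commute with matrices, so they pass through the weight; the conjugate
  transpose in the second entry conjugates their coefficients, as the variable is real.
\<close>

lemma mv_inner_scalar_poly:
  "mv_inner a b W (mat q ** F) G = mv_inner a b W F (mat (map_poly cnj q) ** G)"
proof -
  have "mp_eval (mat q ** F) y ** W y ** conj_transpose (mp_eval G y) =
        mp_eval F y ** W y ** conj_transpose (mp_eval (mat (map_poly cnj q) ** G) y)" for y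
    by (simp add: mp_eval_mult mp_eval_mat conj_transpose_mult conj_transpose_mat
        mat_central[symmetric] matrix_mul_assoc[symmetric] mat_left_commute)
  then show ?thesis unfolding mv_inner_def by simp
qed

section \<open>Orthogonal expansions\<close>

lemma monic_expansion:
  fixes P :: "nat \<Rightarrow> 'n::finite matpoly"
  assumes monic: "\<And>n. mp_monic n (P n)" and "\<And>l. l \<ge> m \<Longrightarrow> mp_coeff F l = 0"
  shows "\<exists>c. F = (\<Sum>j<m. mp_const (c j) ** P j)"
  using assms(2)
proof (induction m arbitrary: F)
  case 0
  then show ?case by (simp add: mp_eq_0_iff[of F])
next
  case (Suc m)
  let ?X = "mp_coeff F m"
  have "mp_coeff (F - mp_const ?X ** P m) l = 0" if "l \<ge> m" for l
    using monic[of m] that Suc.prems[of l]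
    by (cases "l = m") (simp_all add: mp_coeff_diff mp_coeff_const_mult mp_monic_def)
  then obtain c where "F - mp_const ?X ** P m = (\<Sum>j<m. mp_const (c j) ** P j)"
    using Suc.IH by blast
  then have "F = (\<Sum>j<Suc m. mp_const ((c(m := ?X)) j) ** P j)"
    by (simp add: algebra_simps)
  then show ?case by blast
qed

lemma orthogonal_to_lower_degree:
  fixes P :: "nat \<Rightarrow> 'n::finite matpoly"
  assumes W: "matrix_weight a b W" and P: "monic_mvops a b W P"
    and F: "\<And>l. l \<ge> m \<Longrightarrow> mp_coeff F l = 0"
  shows "mv_inner a b W F (P m) = 0" "mv_inner a b W (P m) F = 0"
proof -
  obtain c where "F = (\<Sum>j<m. mp_const (c j) ** P j)"
    using monic_expansion[of P m F] P F unfolding monic_mvops_def by blast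
  moreover have "mv_inner a b W (P j) (P m) = 0" if "j < m" for j
    using P that unfolding monic_mvops_def by auto
  ultimately show "mv_inner a b W F (P m) = 0"
    by (simp add: mv_inner_sum_left[OF W] mv_inner_const_left[OF W])
  then show "mv_inner a b W (P m) F = 0"
    by (metis mv_inner_hermitian[OF W] conj_transpose_0)
qed

text \<open>
  The inner product is nondegenerate on polynomials: the coefficients \<open>c j\<close> of \<open>F\<close> in the basis
  \<open>P j\<close> satisfy \<open>c j ** H j = 0\<close>. Thus an identity between polynomials may be checked by pairing
  both sides with every \<open>P m\<close>.
\<close>

lemma eq_0_if_orthogonal_to_all:
  fixes P :: "nat \<Rightarrow> 'n::finite matpoly"
  assumes W: "matrix_weight a b W" and P: "monic_mvops a b W P"
    and F: "\<And>m. mv_inner a b W F (P m) = 0"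
  shows "F = 0"
proof -
  obtain H where H: "\<And>n. pos_def (H n)"
    and PP: "\<And>n m. mv_inner a b W (P n) (P m) = (if n = m then H n else 0)"
    using P unfolding monic_mvops_def by blast
  obtain d where "\<And>l. l \<ge> Suc d \<Longrightarrow> mp_coeff F l = 0"
    using ex_degree_bound[of F] by (metis Suc_le_lessD)
  then obtain c where c: "F = (\<Sum>j<Suc d. mp_const (c j) ** P j)"
    using monic_expansion[of P "Suc d" F] P unfolding monic_mvops_def by blast
  have "c m = 0" if "m < Suc d" for m
  proof (rule pos_def_cancel_right[OF H[of m]])
    have "(0 :: 'n cmat) = (\<Sum>j<Suc d. c j ** mv_inner a b W (P j) (P m))"
      using F[of m] by (simp only: c mv_inner_sum_left[OF W] mv_inner_const_left[OF W])
    also have "\<dots> = (\<Sum>j<Suc d. if j = m then c j ** H j else 0)"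
      by (intro sum.cong) (auto simp: PP)
    also have "\<dots> = c m ** H m" using that by simp
    finally show "c m ** H m = 0" by simp
  qed
  then show ?thesis by (simp add: c mp_const_0 del: sum.lessThan_Suc)
qed

section \<open>Difference operators\<close>

text \<open>
  Any finite index set that contains the support may replace it, so exact supports never have to be
  known; the true support depends on which recurrence coefficients happen to vanish.
\<close>

lemma dop_act_eq_sum:
  assumes "finite J" "dop_supp S \<subseteq> J"
  shows "dop_act S P n = (\<Sum>j\<in>J. mp_const (S j n) ** zext P (int n + j))"
  unfolding dop_act_def using assms
  by (intro sum.mono_neutral_left) (auto simp: dop_supp_def mp_const_0)

lemma zext_dop_act_eq_sum:
  assumes "finite J" "dop_supp T \<subseteq> J"
  shows "zext (dop_act T P) m = (\<Sum>j\<in>J. mp_const (zext (T j) m) ** zext P (m + j))"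
  using dop_act_eq_sum[OF assms, of P "nat m"] by (auto simp: zext_def mp_const_0)

lemma dop_supp_comp: "dop_supp (dop_comp S T) \<subseteq> (\<lambda>(i, l). i + l) ` (dop_supp S \<times> dop_supp T)"
proof
  fix j assume "j \<in> dop_supp (dop_comp S T)"
  then obtain n where "(\<Sum>i\<in>dop_supp S. S i n ** zext (T (j - i)) (int n + i)) \<noteq> 0"
    by (auto simp: dop_supp_def dop_comp_def)
  then obtain i where i: "i \<in> dop_supp S" "S i n ** zext (T (j - i)) (int n + i) \<noteq> 0"
    by (meson sum.neutral)
  then have "zext (T (j - i)) (int n + i) \<noteq> 0" by auto
  then have "j - i \<in> dop_supp T" by (auto simp: dop_supp_def zext_def split: if_splits)
  with i(1) show "j \<in> (\<lambda>(i, l). i + l) ` (dop_supp S \<times> dop_supp T)"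
    by (intro rev_image_eqI[of "(i, j - i)"]) auto
qed

text \<open>
  Composition represents the composite of the actions. The extension by zero to negative indices is
  consistent: at a negative position \<open>n + i\<close> both the coefficients of \<open>T\<close> and the sequence
  \<open>T \<cdot> P\<close> are set to zero.
\<close>

lemma dop_act_comp:
  assumes S: "finite (dop_supp S)" and T: "finite (dop_supp T)"
  shows "dop_act (dop_comp S T) P n = dop_act S (dop_act T P) n"
proof -
  \<comment> \<open>All possible total shifts; this set serves every inner sum at once, after the
    substitution \<open>l = j - i\<close>.\<close>
  define J where "J = (\<lambda>(i, l). i + l) ` (dop_supp S \<times> dop_supp T)"
  have J: "finite J" unfolding J_def using S T by auto
  have shift: "(\<Sum>j\<in>J. mp_const (zext (T (j - i)) (int n + i)) ** zext P (int n + j))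
             = zext (dop_act T P) (int n + i)" if i: "i \<in> dop_supp S" for i
  proof -
    have sub: "dop_supp T \<subseteq> (\<lambda>j. j - i) ` J"
    proof
      fix l assume "l \<in> dop_supp T"
      with i have "i + l \<in> J" unfolding J_def by (auto intro: rev_image_eqI[of "(i, l)"])
      then show "l \<in> (\<lambda>j. j - i) ` J" by (auto intro: rev_image_eqI[of "i + l"])
    qed
    show ?thesis
      by (subst zext_dop_act_eq_sum[OF _ sub]) (use J in \<open>auto simp: sum.reindex inj_on_def\<close>)
  qed
  have "dop_act (dop_comp S T) P n
      = (\<Sum>j\<in>J. mp_const (dop_comp S T j n) ** zext P (int n + j))"
    by (rule dop_act_eq_sum[OF J]) (use dop_supp_comp[of S T] in \<open>simp add: J_def\<close>)
  also have "\<dots> = (\<Sum>i\<in>dop_supp S. \<Sum>j\<in>J.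
      mp_const (S i n) ** (mp_const (zext (T (j - i)) (int n + i)) ** zext P (int n + j)))"
    by (simp add: dop_comp_def mp_const_sum matrix_mult_sum_left mp_const_mult matrix_mul_assoc)
      (rule sum.swap)
  also have "\<dots> = (\<Sum>i\<in>dop_supp S. mp_const (S i n) ** zext (dop_act T P) (int n + i))"
    by (simp add: matrix_mult_sum_right[symmetric] shift)
  finally show ?thesis by (simp add: dop_act_def)
qed

lemma dop_act_scalar_poly: "dop_act S (\<lambda>n. mat q ** P n) n = mat q ** dop_act S P n"
proof -
  have "zext (\<lambda>n. mat q ** P n) m = mat q ** zext P m" for m
    by (simp add: zext_def)
  then show ?thesis
    by (simp add: dop_act_def matrix_mult_sum_right mat_left_commute)
qed

lemma dop_supp_pow:
  assumes "dop_supp S \<subseteq> {-1..1}"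
  shows "dop_supp (dop_pow S m) \<subseteq> {- int m..int m}"
proof (induction m)
  case 0
  then show ?case by (auto simp: dop_supp_def)
next
  case (Suc m)
  show ?case
  proof
    fix j assume "j \<in> dop_supp (dop_pow S (Suc m))"
    then obtain i l where "j = i + l" "i \<in> dop_supp S" "l \<in> dop_supp (dop_pow S m)"
      using dop_supp_comp[of S "dop_pow S m"] by auto
    with Suc.IH assms show "j \<in> {- int (Suc m)..int (Suc m)}" by fastforce
  qed
qed

lemma dop_supp_poly:
  assumes "dop_supp S \<subseteq> {-1..1}"
  shows "dop_supp (dop_poly q S) \<subseteq> {- int (degree q)..int (degree q)}"
proof
  fix j assume "j \<in> dop_supp (dop_poly q S)"
  then obtain n where "(\<Sum>m\<le>degree q. mat (coeff q m) ** dop_pow S m j n) \<noteq> 0"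
    by (auto simp: dop_supp_def dop_poly_def)
  then obtain m where "m \<le> degree q" "mat (coeff q m) ** dop_pow S m j n \<noteq> 0"
    by (metis (no_types, lifting) sum.neutral atMost_iff)
  moreover from this have "dop_pow S m j n \<noteq> 0" by auto
  ultimately have "m \<le> degree q" "j \<in> dop_supp (dop_pow S m)" by (auto simp: dop_supp_def)
  with dop_supp_pow[OF assms, of m] show "j \<in> {- int (degree q)..int (degree q)}" by fastforce
qed

text \<open>
  A difference operator acts by left multiplication and therefore commutes with the scalar
  polynomial \<open>p\<close>. Hence an eigenvalue equation for \<open>S\<close> can be iterated.
\<close>

lemma dop_act_pow:
  assumes supp: "dop_supp S \<subseteq> {-1..1}" and act: "\<And>n. dop_act S P n = mat p ** P n"
  shows "dop_act (dop_pow S m) P n = mat (p ^ m) ** P n"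
proof (induction m arbitrary: n)
  case 0
  have "dop_act (dop_pow S 0) P n = (\<Sum>j\<in>{0}. mp_const (dop_pow S 0 j n) ** zext P (int n + j))"
    by (rule dop_act_eq_sum) (auto simp: dop_supp_def)
  then show ?case by (simp add: mp_const_mat zext_def one_pCons)
next
  case (Suc m)
  have fin: "finite (dop_supp S)" "finite (dop_supp (dop_pow S m))"
    using supp dop_supp_pow[OF supp] finite_subset finite_atLeastAtMost_int by metis+
  have "dop_act (dop_pow S (Suc m)) P n = dop_act S (\<lambda>n. mat (p ^ m) ** P n) n"
    using dop_act_comp[OF fin, of P n] ext[of "dop_act (dop_pow S m) P", OF Suc.IH] by simp
  also have "\<dots> = mat (p ^ Suc m) ** P n"
    by (simp only: dop_act_scalar_poly act matrix_mul_assoc mat_mult_mat power_Suc mult.commute)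
  finally show ?case .
qed

lemma dop_act_poly:
  assumes supp: "dop_supp S \<subseteq> {-1..1}" and act: "\<And>n. dop_act S P n = mat [:0, 1:] ** P n"
  shows "dop_act (dop_poly q S) P n = mat q ** P n"
proof -
  let ?J = "{- int (degree q)..int (degree q)}"
  have "dop_act (dop_poly q S) P n
      = (\<Sum>j\<in>?J. mp_const (dop_poly q S j n) ** zext P (int n + j))"
    by (rule dop_act_eq_sum[OF _ dop_supp_poly[OF supp]]) simp
  also have "\<dots> = (\<Sum>m\<le>degree q. \<Sum>j\<in>?J.
      mat [:coeff q m:] ** (mp_const (dop_pow S m j n) ** zext P (int n + j)))"
    by (simp add: dop_poly_def mp_const_sum matrix_mult_sum_left mp_const_mult mp_const_mat
        matrix_mul_assoc) (rule sum.swap)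
  also have "\<dots> = (\<Sum>m\<le>degree q. mat [:coeff q m:] ** dop_act (dop_pow S m) P n)"
  proof (rule sum.cong)
    fix m assume "m \<in> {..degree q}"
    then have "dop_supp (dop_pow S m) \<subseteq> ?J" using dop_supp_pow[OF supp, of m] by fastforce
    then show "(\<Sum>j\<in>?J. mat [:coeff q m:] ** (mp_const (dop_pow S m j n) ** zext P (int n + j)))
             = mat [:coeff q m:] ** dop_act (dop_pow S m) P n"
      by (subst dop_act_eq_sum[of ?J]) (simp_all add: matrix_mult_sum_right)
  qed simp
  also have "\<dots> = (\<Sum>m\<le>degree q. mat (monom (coeff q m) m)) ** P n"
    by (simp add: dop_act_pow[OF supp act] matrix_mult_sum_left matrix_mul_assoc mat_mult_mat
        monom_altdef)
  also have "\<dots> = mat q ** P n"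
    by (simp add: mat_sum[symmetric] poly_as_sum_of_monoms)
  finally show ?thesis .
qed

lemma dop_supp_recurrence_op: "dop_supp (recurrence_op B C) \<subseteq> {-1..1}"
  by (auto simp: dop_supp_def recurrence_op_def split: if_splits)

lemma dop_act_recurrence_op:
  assumes "three_term_coeffs P B C"
  shows "dop_act (recurrence_op B C) P n = mat [:0, 1:] ** P n"
proof -
  have "{-1..1::int} = {-1, 0, 1}" by auto
  then have "dop_act (recurrence_op B C) P n
      = (\<Sum>j\<in>{-1, 0, 1}. mp_const (recurrence_op B C j n) ** zext P (int n + j))"
    by (intro dop_act_eq_sum) (use dop_supp_recurrence_op[of B C] in auto)
  also have "\<dots> = mp_const (C n) ** zext P (int n - 1) + mp_const (B n) ** P n + P (n + 1)"
    by (simp add: recurrence_op_def mp_const_mat one_pCons[symmetric] zext_def nat_add_distrib)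
  finally show ?thesis using assms by (simp add: three_term_coeffs_def algebra_simps)
qed

section \<open>The lowering relation\<close>

text \<open>
  By Hermitian symmetry the adjoint relation also describes the adjoint of \<open>\<D>\<^sup>\<dagger> = -\<D> + r\<close>.
  Applying it with the entries exchanged and taking conjugate transposes gives
  \<open>\<langle>r F, G\<rangle> = \<langle>F, r G\<rangle>\<close>, while \<open>\<langle>F, r G\<rangle> = \<langle>\<rho> F, G\<rangle>\<close> holds with the conjugate
  polynomial \<open>\<rho>\<close> of \<open>r\<close>. So \<open>r - \<rho>\<close> is orthogonal to everything.
\<close>

lemma adjoint_potential_real:
  fixes P :: "nat \<Rightarrow> 'n::finite matpoly"
  assumes W: "matrix_weight a b W" and P: "monic_mvops a b W P"
    and adj: "is_adjoint a b W D (\<lambda>G. - D G + mat r ** G)"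
  shows "map_poly cnj r = r"
proof -
  have adj: "mv_inner a b W (D F) G = mv_inner a b W F (mat r ** G) - mv_inner a b W F (D G)" for F G
    using adj mv_inner_diff_right[OF W, of F "mat r ** G" "D G"] unfolding is_adjoint_def by simp
  have "mv_inner a b W (mat r ** F) G = mv_inner a b W F (mat r ** G)" for F G
  proof -
    have "mv_inner a b W (D G) F = mv_inner a b W G (mat r ** F) - mv_inner a b W G (D F)"
      by (rule adj)
    from this[THEN arg_cong, of conj_transpose]
    have "mv_inner a b W F (D G) = mv_inner a b W (mat r ** F) G - mv_inner a b W (D F) G"
      by (simp add: conj_transpose_diff mv_inner_hermitian[OF W])
    then show ?thesis using adj[of F G] by simp
  qed
  from this[of "mat 1"] have sym_mat:
    "mv_inner a b W (mat r) G = mv_inner a b W (mat 1) (mat r ** G)" for G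
    by simp
  then have "mv_inner a b W (mat (r - map_poly cnj r)) G = 0" for G
    using mv_inner_scalar_poly[of a b W "map_poly cnj r" "mat 1" G]
    by (simp add: mat_diff[symmetric] mv_inner_diff_left[OF W] sym_mat map_poly_map_poly o_def)
  then have "mat (r - map_poly cnj r) = (0 :: 'n matpoly)"
    using eq_0_if_orthogonal_to_all[OF W P] by fastforce
  then show ?thesis by (simp add: vec_eq_iff mat_def split: if_splits)
qed

lemma mp_coeff_rdop:
  "mp_coeff (rdop A F) m = mat (of_nat (Suc m)) ** mp_coeff F (Suc m) + mp_coeff F m ** A"
  by (simp add: rdop_def mp_coeff_add mp_coeff_deriv mp_coeff_mult_const)

text \<open>
  Both sides have the same inner product with every \<open>P m\<close>. The term \<open>A\<close> stands outside the sum, so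
  that the identity also covers \<open>k = 0\<close>, where the sum below is empty.
\<close>

lemma rdop_expansion:
  fixes P :: "nat \<Rightarrow> 'n::finite matpoly"
  assumes W: "matrix_weight a b W" and P: "monic_mvops a b W P"
    and rec: "three_term_coeffs P B C" and deg: "degree v = k"
    and adj: "is_adjoint a b W (rdop A) (\<lambda>G. - rdop A G + mat (pderiv v) ** G)"
  defines "R \<equiv> dop_poly (pderiv v) (recurrence_op B C)"
  shows "rdop A (P n) = mp_const A ** P n +
           (\<Sum>j\<in>{- int k + 1..-1}. mp_const (R j n) ** zext P (int n + j))"
proof -
  let ?r = "pderiv v" and ?ip = "mv_inner a b W"
  obtain H where PP: "\<And>n m. ?ip (P n) (P m) = (if n = m then H n else 0)"
    using P unfolding monic_mvops_def by blast
  have monic: "\<And>n. mp_monic n (P n)" using P unfolding monic_mvops_def by blast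
  have deg_rdop: "mp_coeff (rdop A (P n)) l = 0" if "l > n" for l n
    using monic[of n] that by (simp add: mp_coeff_rdop mp_monic_def)
  have supp: "dop_supp R \<subseteq> {- int (k - 1)..int (k - 1)}"
    using dop_supp_poly[OF dop_supp_recurrence_op, of ?r B C] by (simp add: R_def degree_pderiv deg)
  have ip_sum: "?ip (\<Sum>j\<in>J. mp_const (X j) ** zext P (int n + j)) (P m)
      = (if int m - int n \<in> J then X (int m - int n) ** H m else 0)" if "finite J" for J X m
  proof -
    have "?ip (mp_const (X j) ** zext P (int n + j)) (P m)
        = (if j = int m - int n then X j ** H m else 0)" for j
      by (auto simp: mv_inner_const_left[OF W] PP zext_def mv_inner_0_left)
    then show ?thesis using that by (simp add: mv_inner_sum_left[OF W])
  qed
  \<comment> \<open>Below the diagonal the adjoint relation produces the entries of \<open>r(L)\<close>.\<close>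
  have low: "?ip (rdop A (P n)) (P m) = R (int m - int n) n ** H m" if "m < n" for m
  proof -
    have "?ip (rdop A (P n)) (P m) = ?ip (P n) (mat ?r ** P m - rdop A (P m))"
      using adj by (simp add: is_adjoint_def)
    also have "\<dots> = ?ip (P n) (mat ?r ** P m)"
      using orthogonal_to_lower_degree(2)[OF W P deg_rdop, of n m] that
      by (simp add: mv_inner_diff_right[OF W])
    also have "\<dots> = ?ip (mat ?r ** P n) (P m)"
      by (simp add: mv_inner_scalar_poly adjoint_potential_real[OF W P adj])
    also have "mat ?r ** P n = dop_act R P n"
      unfolding R_def
      by (rule dop_act_poly[symmetric, OF dop_supp_recurrence_op dop_act_recurrence_op[OF rec]])
    also have "dop_act R P n =
        (\<Sum>j\<in>{- int (k - 1)..int (k - 1)}. mp_const (R j n) ** zext P (int n + j))"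
      by (rule dop_act_eq_sum[OF _ supp]) simp
    also have "?ip \<dots> (P m) = R (int m - int n) n ** H m"
    proof (subst ip_sum)
      have "R (int m - int n) n = 0" if "int m - int n \<notin> {- int (k - 1)..int (k - 1)}"
        using supp that unfolding dop_supp_def by blast
      then show "(if int m - int n \<in> {- int (k - 1)..int (k - 1)}
          then R (int m - int n) n ** H m else 0) = R (int m - int n) n ** H m"
        by auto
    qed simp
    finally show ?thesis .
  qed
  \<comment> \<open>On and above the diagonal it suffices to compare degrees: removing \<open>A P n\<close> lowers the
    degree below \<open>n\<close>.\<close>
  have high: "?ip (rdop A (P n) - mp_const A ** P n) (P m) = 0" if "m \<ge> n" for m
  proof (rule orthogonal_to_lower_degree(1)[OF W P])
    fix l assume "l \<ge> m"
    with that monic[of n] show "mp_coeff (rdop A (P n) - mp_const A ** P n) l = 0"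
      by (cases "l = n")
        (simp_all add: mp_coeff_diff mp_coeff_rdop mp_coeff_const_mult mp_monic_def)
  qed
  let ?S = "\<Sum>j\<in>{- int k + 1..-1}. mp_const (R j n) ** zext P (int n + j)"
  have "rdop A (P n) - mp_const A ** P n - ?S = 0"
  proof (rule eq_0_if_orthogonal_to_all[OF W P])
    fix m
    show "?ip (rdop A (P n) - mp_const A ** P n - ?S) (P m) = 0"
    proof (cases "m < n")
      case True
      then have "R (int m - int n) n = 0" if "\<not> int m - int n \<ge> - int k + 1"
        using supp that by (force simp: dop_supp_def)
      with True show ?thesis
        by (auto simp: mv_inner_diff_left[OF W] low ip_sum mv_inner_const_left[OF W] PP)
    next
      case False
      then show ?thesis
        using high[of m] by (simp add: mv_inner_diff_left[OF W] ip_sum)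
    qed
  qed
  then show ?thesis by (simp add: algebra_simps)
qed

text \<open>
  With \<open>X\<close> the constant coefficient of \<open>F\<close>, equality would give \<open>I + X A = A X\<close>. A commutator has
  trace zero, but the identity does not.
\<close>

lemma rdop_monic_linear_neq:
  fixes F :: "'n::finite matpoly"
  assumes "mp_monic 1 F"
  shows "rdop A F \<noteq> mp_const A ** F"
proof
  assume "rdop A F = mp_const A ** F"
  then have "mp_coeff (rdop A F) 0 = mp_coeff (mp_const A ** F) 0" by simp
  then have "mat 1 + mp_coeff F 0 ** A = A ** mp_coeff F 0"
    using assms by (simp add: mp_coeff_rdop mp_coeff_const_mult mp_monic_def)
  from this[THEN arg_cong, of trace]
  have "(of_nat CARD('n) :: complex) = 0"
    by (simp add: trace_add trace_I trace_mul_sym[of A])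
  then show False by simp
qed

theorem theorem3p2:
  fixes a b :: ereal
    and W :: "real \<Rightarrow> complex^'n^'n"
    and P :: "nat \<Rightarrow> (complex poly)^'n^'n"
    and B C :: "nat \<Rightarrow> complex^'n^'n"
    and A :: "complex^'n^'n"
    and v :: "complex poly"
    and k :: nat
    and L M :: "int \<Rightarrow> nat \<Rightarrow> complex^'n^'n"
  assumes "matrix_weight a b W"
    and "monic_mvops a b W P"
    and "three_term_coeffs P B C"
    and "degree v = k"
    and "is_adjoint a b W (rdop A) (\<lambda>G. - rdop A G + mat (pderiv v) ** G)"
  defines "L \<equiv> recurrence_op B C"
    and "M \<equiv> (\<lambda>j n. if j \<in> {- int k + 1..0}
                     then (if j = 0 then A else dop_poly (pderiv v) L j n) else 0)"
  shows "(\<forall>n. rdop A (P n) = dop_act M P n) \<and>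
         (\<forall>n. mp_deriv (P n) + P n ** mp_const A =
           (\<Sum>j\<in>{- int k + 1..0}.
              mp_const (if j = 0 then A else dop_poly (pderiv v) L j n) ** zext P (int n + j)))"
proof -
  let ?R = "dop_poly (pderiv v) L" and ?c = "\<lambda>j n. if j = 0 then A else dop_poly (pderiv v) L j n"
  have exp: "rdop A (P n) = mp_const A ** P n +
      (\<Sum>j\<in>{- int k + 1..-1}. mp_const (?R j n) ** zext P (int n + j))" for n
    unfolding L_def by (rule rdop_expansion[OF assms(1-5)])
  \<comment> \<open>For \<open>k = 0\<close> the index range \<open>{- int k + 1..0}\<close> would not contain \<open>0\<close>.\<close>
  have "k \<noteq> 0"
  proof
    assume "k = 0"
    with exp[of 1] have "rdop A (P 1) = mp_const A ** P 1" by simp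
    moreover have "mp_monic 1 (P 1)" using assms(2) unfolding monic_mvops_def by blast
    ultimately show False using rdop_monic_linear_neq by blast
  qed
  then have split: "{- int k + 1..0} = insert 0 {- int k + 1..-1}" by auto
  have main: "rdop A (P n) =
      (\<Sum>j\<in>{- int k + 1..0}. mp_const (?c j n) ** zext P (int n + j))" for n
  proof -
    have "(\<Sum>j\<in>{- int k + 1..-1}. mp_const (?c j n) ** zext P (int n + j)) =
        (\<Sum>j\<in>{- int k + 1..-1}. mp_const (?R j n) ** zext P (int n + j))"
      by (rule sum.cong) auto
    then show ?thesis
      unfolding split exp by (simp add: zext_def)
  qed
  have "dop_act M P n = rdop A (P n)" for n
  proof -
    have "dop_act M P n = (\<Sum>j\<in>{- int k + 1..0}. mp_const (M j n) ** zext P (int n + j))"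
      by (rule dop_act_eq_sum) (auto simp: dop_supp_def M_def split: if_splits)
    also have "\<dots> = rdop A (P n)"
      unfolding main by (intro sum.cong) (auto simp: M_def)
    finally show ?thesis .
  qed
  with main show ?thesis by (simp add: rdop_def)
qed

end
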